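(* Fix $m\ge 1$ and let $\{a_n\}_{n\ge0}$ be the $m$-gonal sequence. Every positive integer can be written uniquely as a sum of distinct terms of the $m$-gonal sequence in which no two summands lie in the same bin.
   Context: For an increasing sequence of positive integers $\{a_n\}_{n=0}^\infty$, the bins are $b_0=[a_0]$ and, for $k\ge1$, $b_k=[a_{m(k-1)+1},\dots,a_{mk}]$. A legal $m$-gonal decomposition of $z$ is $z=a_{\ell_t}+\cdots+a_{\ell_1}$ with $\ell_1<\cdots<\ell_t$ and no two summands in the same bin. The $m$-gonal sequence is defined recursively: each $a_i$ ($i\ge 0$) is the smallest positive integer that has no legal $m$-gonal decomposition using only $a_0,\dots,a_{i-1}$. *)

theory Defs
  imports Main
begin

text \<open>
  Bins are represented by the indices of their terms. The terms are pairwise distinct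
  (lemma \<open>strict_mono_mgonal_seq\<close> below), so sets of indices correspond to sets of terms.
\<close>

definition bin :: "nat \<Rightarrow> nat \<Rightarrow> nat set" where
  "bin m k = (if k = 0 then {0} else {m * (k - 1) + 1..m * k})"

text \<open>The set \<open>L\<close> is the set of indices \<open>{l\<^sub>1 < \<dots> < l\<^sub>t}\<close> of the summands.\<close>

definition legal_decomposition :: "nat \<Rightarrow> (nat \<Rightarrow> nat) \<Rightarrow> nat set \<Rightarrow> nat \<Rightarrow> bool" where
  "legal_decomposition m a L z \<longleftrightarrow>
     finite L \<and>
     (\<forall>i\<in>L. \<forall>j\<in>L. i \<noteq> j \<longrightarrow> \<not> (\<exists>k. i \<in> bin m k \<and> j \<in> bin m k)) \<and>
     z = (\<Sum>i\<in>L. a i)"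

text \<open>
  The conditional only serves the termination proof: since \<open>L \<subseteq> {..<n}\<close>, the value \<open>0\<close> is
  never used. Lemma \<open>mgonal_seq_eq\<close> is the same recursion without it.
\<close>

fun mgonal_seq :: "nat \<Rightarrow> nat \<Rightarrow> nat" where
  "mgonal_seq m n =
     (LEAST z. 0 < z \<and>
        \<not> (\<exists>L\<subseteq>{..<n}. legal_decomposition m (\<lambda>i. if i < n then mgonal_seq m i else 0) L z))"

declare mgonal_seq.simps [simp del]

lemma legal_decomposition_cong:
  assumes "\<And>i. i \<in> L \<Longrightarrow> a i = b i"
  shows "legal_decomposition m a L z \<longleftrightarrow> legal_decomposition m b L z"
proof -
  have "(\<Sum>i\<in>L. a i) = (\<Sum>i\<in>L. b i)"
    using assms by (rule sum.cong[OF refl])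
  then show ?thesis
    by (simp add: legal_decomposition_def)
qed

lemma mgonal_seq_eq:
  "mgonal_seq m n =
     (LEAST z. 0 < z \<and> \<not> (\<exists>L\<subseteq>{..<n}. legal_decomposition m (mgonal_seq m) L z))"
proof -
  have "legal_decomposition m (\<lambda>i. if i < n then mgonal_seq m i else 0) L z \<longleftrightarrow>
        legal_decomposition m (mgonal_seq m) L z" if "L \<subseteq> {..<n}" for L z
    using that by (intro legal_decomposition_cong) auto
  then have "(0 < z \<and> \<not> (\<exists>L\<subseteq>{..<n}. legal_decomposition m (\<lambda>i. if i < n then mgonal_seq m i else 0) L z)) \<longleftrightarrow>
        (0 < z \<and> \<not> (\<exists>L\<subseteq>{..<n}. legal_decomposition m (mgonal_seq m) L z))" for z
    by blast
  then show ?thesis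
    by (simp only: mgonal_seq.simps[of m n])
qed

text \<open>The minimum in the definition exists.\<close>

lemma mgonal_seq_candidate:
  "\<exists>z>0. \<not> (\<exists>L\<subseteq>{..<n}. legal_decomposition m a L z)"
proof -
  let ?z = "Suc (\<Sum>i<n. a i)"
  have "\<not> legal_decomposition m a L ?z" if "L \<subseteq> {..<n}" for L
  proof
    assume "legal_decomposition m a L ?z"
    then have "(\<Sum>i\<in>L. a i) = ?z"
      by (simp add: legal_decomposition_def)
    moreover have "(\<Sum>i\<in>L. a i) \<le> (\<Sum>i<n. a i)"
      using that by (intro sum_mono2) auto
    ultimately show False by simp
  qed
  then have "0 < ?z \<and> \<not> (\<exists>L\<subseteq>{..<n}. legal_decomposition m a L ?z)" by simp
  then show ?thesis by (rule exI)
qed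

lemma mgonal_seq_least:
  shows mgonal_seq_pos: "0 < mgonal_seq m n"
    and mgonal_seq_no_decomposition:
      "L \<subseteq> {..<n} \<Longrightarrow> \<not> legal_decomposition m (mgonal_seq m) L (mgonal_seq m n)"
    and mgonal_seq_minimal:
      "0 < z \<Longrightarrow> z < mgonal_seq m n \<Longrightarrow> \<exists>L\<subseteq>{..<n}. legal_decomposition m (mgonal_seq m) L z"
proof -
  let ?P = "\<lambda>z. 0 < z \<and> \<not> (\<exists>L\<subseteq>{..<n}. legal_decomposition m (mgonal_seq m) L z)"
  have "?P (LEAST z. ?P z)"
    using mgonal_seq_candidate[of n m "mgonal_seq m"] by (rule LeastI_ex)
  then have P: "?P (mgonal_seq m n)"
    unfolding mgonal_seq_eq[of m n, symmetric] .
  show "0 < mgonal_seq m n"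
    using P by blast
  show "L \<subseteq> {..<n} \<Longrightarrow> \<not> legal_decomposition m (mgonal_seq m) L (mgonal_seq m n)"
    using P by blast
  show "\<exists>L\<subseteq>{..<n}. legal_decomposition m (mgonal_seq m) L z"
    if "0 < z" "z < mgonal_seq m n"
  proof -
    have "z < (LEAST z. ?P z)"
      using that(2) unfolding mgonal_seq_eq[of m n, symmetric] .
    then have "\<not> ?P z" by (rule not_less_Least)
    then show ?thesis using that(1) by blast
  qed
qed

lemma strict_mono_mgonal_seq: "strict_mono (mgonal_seq m)"
proof (unfold strict_mono_Suc_iff, rule allI, rule ccontr)
  fix n
  assume "\<not> mgonal_seq m n < mgonal_seq m (Suc n)"
  then consider "mgonal_seq m (Suc n) = mgonal_seq m n" | "mgonal_seq m (Suc n) < mgonal_seq m n"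
    by linarith
  then have "\<exists>L\<subseteq>{..<Suc n}. legal_decomposition m (mgonal_seq m) L (mgonal_seq m (Suc n))"
  proof cases
    case 1
    then have "legal_decomposition m (mgonal_seq m) {n} (mgonal_seq m (Suc n))"
      by (simp add: legal_decomposition_def)
    moreover have "{n} \<subseteq> {..<Suc n}" by simp
    ultimately show ?thesis by blast
  next
    case 2
    then obtain L where L: "L \<subseteq> {..<n}"
      "legal_decomposition m (mgonal_seq m) L (mgonal_seq m (Suc n))"
      using mgonal_seq_minimal[OF mgonal_seq_pos 2] by auto
    have "L \<subseteq> {..<Suc n}" using L(1) by (auto simp: less_Suc_eq)
    with L(2) show ?thesis by blast
  qed
  then obtain L where "L \<subseteq> {..<Suc n}"
    "legal_decomposition m (mgonal_seq m) L (mgonal_seq m (Suc n))" by auto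
  then show False using mgonal_seq_no_decomposition[of L "Suc n" m] by simp
qed

end

theory Submission imports Defs begin

text \<open>
  Let \<open>s\<close> be the first index of the bin containing \<open>n\<close>. A legal set of indices below \<open>n + 1\<close>
  either avoids \<open>n\<close>, or is \<open>n\<close> together with a legal set of indices below \<open>s\<close>. If taking sums
  maps the legal sets below \<open>n\<close> and below \<open>s\<close> bijectively onto \<open>[0, a\<^sub>n)\<close> and \<open>[0, a\<^sub>s)\<close>, then
  it maps those below \<open>n + 1\<close> bijectively onto \<open>[0, a\<^sub>n) \<union> [a\<^sub>n, a\<^sub>n + a\<^sub>s)\<close>, and minimality of
  \<open>a\<^sub>n\<^sub>+\<^sub>1\<close> forces \<open>a\<^sub>n\<^sub>+\<^sub>1 = a\<^sub>n + a\<^sub>s\<close>. By induction this holds for all \<open>n\<close>.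
\<close>

text \<open>Index 0 is split off because truncated subtraction would put it in bin 1.\<close>

definition bin_start :: "nat \<Rightarrow> nat \<Rightarrow> nat" where
  "bin_start m n = (if n = 0 then 0 else Suc (m * ((n - 1) div m)))"

text \<open>Legality is separated from the value, so that \<open>sum\<close> becomes a map to which
  \<open>bij_betw\<close> applies; the bound gives finiteness.\<close>

definition legal_sets :: "nat \<Rightarrow> nat \<Rightarrow> nat set set" where
  "legal_sets m n = {L. L \<subseteq> {..<n} \<and>
     (\<forall>i\<in>L. \<forall>j\<in>L. i \<noteq> j \<longrightarrow> \<not> (\<exists>k. i \<in> bin m k \<and> j \<in> bin m k))}"

lemma bin_start_le: "bin_start m n \<le> n"
proof (cases n)
  case (Suc k)
  then show ?thesis by (simp add: bin_start_def)
qed (simp add: bin_start_def)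

text \<open>Bins are intervals, so an index below \<open>n\<close> only has to clear the left end of
  the bin of \<open>n\<close>; bin 0 is a singleton and cannot hold both.\<close>

lemma same_bin_iff:
  assumes "m \<ge> 1" and "i < n"
  shows "(\<exists>k. i \<in> bin m k \<and> n \<in> bin m k) \<longleftrightarrow> bin_start m n \<le> i"
proof
  assume "\<exists>k. i \<in> bin m k \<and> n \<in> bin m k"
  then obtain k where k: "i \<in> bin m k" "n \<in> bin m k" by blast
  with assms(2) obtain q where q: "k = Suc q"
    by (cases k) (auto simp: bin_def)
  have n: "m * q \<le> n - 1" "n - 1 < m * Suc q" "0 < n"
    using k(2) q assms by (auto simp: bin_def)
  then have "(n - 1) div m = q"
    by (intro div_nat_eqI) (simp_all add: mult.commute)
  then show "bin_start m n \<le> i"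
    using k(1) q n(3) by (simp add: bin_start_def bin_def)
next
  assume start: "bin_start m n \<le> i"
  let ?q = "(n - 1) div m"
  have "n - 1 < m * Suc ?q"
    using assms(1) dividend_less_times_div[of m "n - 1"] by simp
  moreover have "m * ?q \<le> n - 1" by simp
  ultimately have "n \<in> bin m (Suc ?q)" and "i \<in> bin m (Suc ?q)"
    using start assms(2) by (auto simp: bin_def bin_start_def)
  then show "\<exists>k. i \<in> bin m k \<and> n \<in> bin m k" by blast
qed

text \<open>Sets of naturals are finite exactly when they are bounded.\<close>

lemma legal_decomposition_iff_legal_sets:
  "legal_decomposition m a L z \<longleftrightarrow> (\<exists>n. L \<in> legal_sets m n) \<and> sum a L = z"
  by (auto simp: legal_decomposition_def legal_sets_def finite_nat_set_iff_bounded subset_eq)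

lemma legal_sets_bounded_decomposition:
  "L \<subseteq> {..<n} \<and> legal_decomposition m a L z \<longleftrightarrow> L \<in> legal_sets m n \<and> sum a L = z"
  by (auto simp: legal_decomposition_def legal_sets_def finite_subset)

lemma legal_sets_mono: "n \<le> n' \<Longrightarrow> legal_sets m n \<subseteq> legal_sets m n'"
  by (auto simp: legal_sets_def)

lemma legal_sets_0: "legal_sets m 0 = {{}}"
  by (auto simp: legal_sets_def)

text \<open>The indices below \<open>n\<close> in conflict with \<open>n\<close> form a top segment,
  so containing \<open>n\<close> merely lowers the bound on the other indices.\<close>

lemma legal_sets_Suc:
  assumes "m \<ge> 1"
  shows "legal_sets m (Suc n) = legal_sets m n \<union> insert n ` legal_sets m (bin_start m n)"
    (is "?A = ?B \<union> ?C")
proof (intro equalityI subsetI)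
  fix L assume L: "L \<in> ?A"
  show "L \<in> ?B \<union> ?C"
  proof (cases "n \<in> L")
    case False
    with L have "L \<in> ?B" by (auto simp: legal_sets_def less_Suc_eq)
    then show ?thesis ..
  next
    case True
    have "i < bin_start m n" if "i \<in> L - {n}" for i
    proof -
      have "i < n" using that L by (auto simp: legal_sets_def less_Suc_eq)
      moreover have "\<not> (\<exists>k. i \<in> bin m k \<and> n \<in> bin m k)"
        using that L True unfolding legal_sets_def by blast
      ultimately show ?thesis using same_bin_iff[OF assms] by (simp add: not_le)
    qed
    then have "L - {n} \<subseteq> {..<bin_start m n}" by blast
    then have "L - {n} \<in> legal_sets m (bin_start m n)"
      using L unfolding legal_sets_def by blast
    moreover have "L = insert n (L - {n})" using True by blast
    ultimately show ?thesis by blast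
  qed
next
  fix L assume "L \<in> ?B \<union> ?C"
  then show "L \<in> ?A"
  proof
    assume "L \<in> ?B"
    then show ?thesis using legal_sets_mono[of n "Suc n"] by auto
  next
    assume "L \<in> ?C"
    then obtain M where M: "M \<in> legal_sets m (bin_start m n)" and L: "L = insert n M" by blast
    have "i < n \<and> \<not> (\<exists>k. i \<in> bin m k \<and> n \<in> bin m k)" if "i \<in> M" for i
    proof -
      have "i < bin_start m n" using M that by (auto simp: legal_sets_def)
      then show ?thesis using bin_start_le[of m n] same_bin_iff[OF assms, of i n] by simp
    qed
    with M show ?thesis
      unfolding L legal_sets_def by (fastforce simp: less_Suc_eq)
  qed
qed

text \<open>The least positive integer outside \<open>{..<c}\<close> is \<open>c\<close>, once
  \<open>c\<close> is known to be positive.\<close>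

lemma mgonal_seq_eqI:
  assumes "sum (mgonal_seq m) ` legal_sets m n = {..<c}"
  shows "mgonal_seq m n = c"
proof -
  let ?a = "mgonal_seq m"
  have rep: "(\<exists>L\<subseteq>{..<n}. legal_decomposition m ?a L z) \<longleftrightarrow> z < c" for z
  proof -
    have "(\<exists>L\<subseteq>{..<n}. legal_decomposition m ?a L z) \<longleftrightarrow> z \<in> sum ?a ` legal_sets m n"
      unfolding legal_sets_bounded_decomposition by auto
    then show ?thesis using assms by simp
  qed
  \<comment> \<open>The empty sum 0 lies in the image, hence \<open>0 < c\<close>.\<close>
  have "{} \<in> legal_sets m n" by (simp add: legal_sets_def)
  then have "sum ?a {} \<in> {..<c}" unfolding assms[symmetric] by (rule imageI)
  then have "0 < c" by simp
  moreover have "\<not> ?a n < c"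
    using mgonal_seq_no_decomposition[of _ n m] rep by blast
  ultimately show ?thesis
    using mgonal_seq_minimal[of c m n] rep[of c] by fastforce
qed

text \<open>The induction is strong because the step from \<open>p\<close> to \<open>Suc p\<close>
  uses the claim at \<open>p\<close> and at \<open>bin_start m p\<close>.\<close>

lemma bij_betw_legal_sets:
  assumes "m \<ge> 1"
  shows "bij_betw (sum (mgonal_seq m)) (legal_sets m n) {..<mgonal_seq m n}"
proof (induction n rule: less_induct)
  case (less n)
  let ?a = "mgonal_seq m"
  \<comment> \<open>Any endpoint will do: \<open>mgonal_seq_eqI\<close> then identifies it with
    \<open>?a n\<close>.\<close>
  have "\<exists>c. bij_betw (sum ?a) (legal_sets m n) {..<c}"
  proof (cases n)
    case 0
    have "bij_betw (sum ?a) (legal_sets m n) {..<1}"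
      by (simp add: 0 legal_sets_0 bij_betw_def lessThan_Suc)
    then show ?thesis ..
  next
    case (Suc p)
    let ?s = "bin_start m p"
    have below: "bij_betw (sum ?a) (legal_sets m p) {..<?a p}"
      using less.IH[of p] Suc by simp
    have start: "bij_betw (sum ?a) (legal_sets m ?s) {..<?a ?s}"
      using less.IH[of ?s] Suc bin_start_le[of m p] by simp
    have new: "L \<subseteq> {..<p}" if "L \<in> legal_sets m ?s" for L
      using that bin_start_le[of m p] by (auto simp: legal_sets_def)
    have sum_insert: "sum ?a (insert p L) = ?a p + sum ?a L" if "L \<in> legal_sets m ?s" for L
      using new[OF that] by (subst sum.insert) (auto intro: finite_subset)
    have "bij_betw (\<lambda>x. ?a p + x) {..<?a ?s} {?a p..<?a p + ?a ?s}"
      by (simp add: bij_betw_def lessThan_atLeast0 add.commute)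
    with start have "bij_betw ((\<lambda>x. ?a p + x) \<circ> sum ?a) (legal_sets m ?s) {?a p..<?a p + ?a ?s}"
      by (rule bij_betw_trans)
    \<comment> \<open>Translating the sum by \<open>?a p\<close> amounts to inserting
      \<open>p\<close>, and the injective map \<open>insert p\<close> can then be cancelled.\<close>
    then have "bij_betw (sum ?a \<circ> insert p) (legal_sets m ?s) {?a p..<?a p + ?a ?s}"
      by (rule bij_betw_cong[THEN iffD1, rotated]) (simp add: sum_insert)
    moreover have "inj_on (insert p) (legal_sets m ?s)"
    proof (rule inj_onI)
      fix L M assume "L \<in> legal_sets m ?s" "M \<in> legal_sets m ?s" "insert p L = insert p M"
      then show "L = M" using new[of L] new[of M] by (metis insert_ident lessThan_iff less_irrefl subsetD)
    qed
    ultimately have "bij_betw (sum ?a) (insert p ` legal_sets m ?s) {?a p..<?a p + ?a ?s}"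
      using bij_betw_comp_iff[OF inj_on_imp_bij_betw] by blast
    with below have "bij_betw (sum ?a) (legal_sets m (Suc p)) ({..<?a p} \<union> {?a p..<?a p + ?a ?s})"
      unfolding legal_sets_Suc[OF assms] by (rule bij_betw_combine) auto
    moreover have "{..<?a p} \<union> {?a p..<?a p + ?a ?s} = {..<?a p + ?a ?s}" by auto
    ultimately show ?thesis using Suc by auto
  qed
  then obtain c where c: "bij_betw (sum ?a) (legal_sets m n) {..<c}" ..
  then have "?a n = c" by (intro mgonal_seq_eqI) (rule bij_betw_imp_surj_on)
  with c show ?case by simp
qed

theorem theorem1p5:
  fixes m z :: nat
  assumes "m \<ge> 1" and "z > 0"
  shows "\<exists>!L. legal_decomposition m (mgonal_seq m) L z"
proof -
  let ?a = "mgonal_seq m"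
  note bij = bij_betw_legal_sets[OF assms(1)]
  \<comment> \<open>A strictly increasing sequence of naturals satisfies
    \<open>n \<le> ?a n\<close>, so the bound \<open>Suc z\<close> reaches \<open>z\<close>.\<close>
  have "z < ?a (Suc z)"
    using strict_mono_imp_increasing[OF strict_mono_mgonal_seq, of "Suc z" m] by simp
  then have "z \<in> sum ?a ` legal_sets m (Suc z)"
    using bij_betw_imp_surj_on[OF bij, of "Suc z"] by simp
  then obtain L where L: "legal_decomposition m ?a L z"
    unfolding legal_decomposition_iff_legal_sets by blast
  moreover have "M = L" if M: "legal_decomposition m ?a M z" for M
  proof -
    \<comment> \<open>The two sets may come with different bounds; injectivity is applied at their
      maximum.\<close>
    obtain n n' where "L \<in> legal_sets m n" "M \<in> legal_sets m n'"
      using L M unfolding legal_decomposition_iff_legal_sets by blast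
    then have "L \<in> legal_sets m (max n n')" "M \<in> legal_sets m (max n n')"
      using legal_sets_mono[of n "max n n'"] legal_sets_mono[of n' "max n n'"] by auto
    moreover have "sum ?a M = sum ?a L"
      using L M by (simp add: legal_decomposition_def)
    ultimately show ?thesis
      using bij_betw_imp_inj_on[OF bij] by (blast dest: inj_onD)
  qed
  ultimately show ?thesis by blast
qed

end
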